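(* Let $\mathbb F$ be an algebraically closed field and let $q\in\mathbb F$ be nonzero and not a root of unity. Let $V$ be an evaluation module for $\boxtimes_q$, with diameter $d$ and evaluation parameter $t$. Let $\eta_i\in V$, $\eta^*_i\in V^*$ $(i\in\mathbb Z_4)$ be nonzero vectors in component $0$ of the flag $[i]$ on $V$, respectively $V^*$. Let $\mathcal X$ denote the standard exchanger for $V$. For mutually distinct $i,j,k,\ell$ in $\mathbb Z_4$, consider the bases $[i,j,k,\ell]$ and $[i+2,j+2,k+2,\ell+2]$ of $V$. The map $\mathcal X$ sends $[i,j,k,\ell]$ to a scalar multiple of $[i+2,j+2,k+2,\ell+2]$. The scalar depends only on $j$ and is equal to $$q^{-\binom d2}\frac{(\eta_0,\eta_1^* )}{(\eta_2,\eta_1^* )}\ \text{ if } j=0,\qquad (-1)^dq^{\binom d2}\frac{(\eta_1,\eta_0^* )}{(\eta_3,\eta_0^* )}\ \text{ if } j=1,$$ $$q^{-\binom d2}\frac{(\eta_2,\eta_3^* )}{(\eta_0,\eta_3^* )}\ \text{ if } j=2,\qquad (-1)^dq^{\binom d2}\frac{(\eta_3,\eta_2^* )}{(\eta_1,\eta_2^* )}\ \text{ if } j=3.$$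
   Context: Algebras are associative with 1. $[n]_q=(q^n-q^{-n})/(q-q^{-1})$ and $\mathbb Z_4=\mathbb Z/4\mathbb Z$. The $q$-tetrahedron algebra $\boxtimes_q$ is the $\mathbb F$-algebra with generators (called the standard generators) $\{x_{ij}\mid i,j\in\mathbb Z_4,\ j-i=1\text{ or }j-i=2\}$ and relations: (i) $x_{ij}x_{ji}=1$ if $j-i=2$; (ii) $\frac{qx_{ij}x_{jk}-q^{-1}x_{jk}x_{ij}}{q-q^{-1}}=1$ if $(j-i,k-j)$ is one of $(1,1),(1,2),(2,1)$; (iii) $x_{ij}^3x_{k\ell}-[3]_qx_{ij}^2x_{k\ell}x_{ij}+[3]_qx_{ij}x_{k\ell}x_{ij}^2-x_{k\ell}x_{ij}^3=0$ if $j-i=k-j=\ell-k=1$. Known fact: on a finite-dimensional irreducible $\boxtimes_q$-module $V$ there are $d\in\mathbb N$ (the diameter) and $\varepsilon\in\{1,-1\}$ (the type) such that each standard generator is diagonalizable with set of distinct eigenvalues $\{\varepsilon q^{d-2n}\mid 0\le n\le d\}$. Let $V$ have type 1. For distinct $i,j\in\mathbb Z_4$ the decomposition $[i,j]$ of $V$ is the sequence of subspaces $\{V_n\}_{n=0}^d$ (with $V=\bigoplus_n V_n$) such that: if $j-i\in\{1,2\}$, $V_n$ is the eigenspace of $x_{ij}$ with eigenvalue $q^{d-2n}$; if $j-i=3$, $[i,j]$ is the inversion (reversed sequence) of $[j,i]$. The shape $(\dim V_n)_{n=0}^d$ does not depend on $i,j$. For $i\in\mathbb Z_4$ the flag $[i]$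 on $V$ has $n$th component $V_0+\cdots+V_n$, where $\{V_n\}$ is the decomposition $[i,j]$; this is known not to depend on $j\ne i$. The trivial $\boxtimes_q$-module is the one-dimensional module on which every standard generator acts as the identity. An evaluation module for $\boxtimes_q$ is a nontrivial finite-dimensional irreducible $\boxtimes_q$-module of type 1 and shape $(1,1,\dots,1)$ (so $d\ge1$, $\dim V=d+1$). Dual space: $V^*$ is the space of linear maps $V\to\mathbb F$, $(u,f)=f(u)$ for $u\in V,f\in V^*$. $V^*$ is a $\boxtimes_{q^{-1}}$-module in which each standard generator $x_{ij}$ of $\boxtimes_{q^{-1}}$ acts as the adjoint of $x_{ij}$ on $V$: $(x_{ij}u,v)=(u,x_{ij}v)$. This module is again an evaluation module (for $\boxtimes_{q^{-1}}$) of diameter $d$. For distinct $i,j\in\mathbb Z_4$ the decomposition $[i,j]$ of $V^*$ is the sequence of subspaces $\{W_n\}_{n=0}^d$ (with $V^*=\bigoplus_n W_n$) such that: if $j-i\in\{1,2\}$, $W_n$ is the eigenspace of $x_{ij}$ on $V^*$ with eigenvalue $q^{2n-d}$; if $j-i=3$, the decomposition $[i,j]$ of $V^*$ is the inversion of the decomposition $[j,i]$ of $V^*$. For $i\in\mathbb Z_4$ the flag $[i]$ on $V^*$ has $n$th component $W_0+\cdots+W_n$, where $\{W_n\}$ is the decomposition $[i,j]$ of $V^*$; this does not depend on $j\ne i$. In particular $x_{i,i+1}\eta_i=q^d\eta_i$ and $x_{i,i+1}\eta^*_i=q^{-d}\eta^*_i$. One has $(\eta_i,\eta_j^* )\ne0$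 for $i\ne j$. Normalized bases: for mutually distinct $i,j,k,\ell\in\mathbb Z_4$, $[i,j,k,\ell]$ denotes the unique basis $\{u_n\}_{n=0}^d$ of $V$ such that $u_n$ is in component $n$ of the decomposition $[k,\ell]$ of $V$ for $0\le n\le d$, and $\eta_j=\sum_{n=0}^du_n$. "$\mathcal X$ sends the basis $\{u_n\}$ to the scalar multiple $\alpha$ of the basis $\{v_n\}$" means $\mathcal Xu_n=\alpha v_n$ for $0\le n\le d$. An exchanger for $V$ is an invertible $X\in{\rm End}(V)$ such that $Xx_{ij}X^{-1}=x_{i+2,j+2}$ holds on $V$ for each standard generator $x_{ij}$. The standard exchanger $\mathcal X$ for $V$ is the exchanger that is represented with respect to the basis $[0,2,1,3]$ by the matrix with $(i,j)$-entry $\delta_{i+j,d}\,t^iq^{i(d-1)-\binom d2}$ ($0\le i,j\le d$). Matrices in ${\rm Mat}_{d+1}(\mathbb F)$ have rows and columns indexed by $0,\dots,d$; $M$ represents $A$ with respect to $\{v_n\}_{n=0}^d$ when $Av_n=\sum_i M_{in}v_i$. Entries not mentioned below are $0$. A subscript $q^{-1}$ means that $q$ is replaced by $q^{-1}$ in the definition (and similarly $t^{-1}$ as argument). - $Z$: $(i,j)$-entry $\delta_{i+j,d}$. - $K_q$: diagonal, $(i,i)$-entry $q^{d-2i}$. - $E_q$: $(i,i)$-entry $q^{2i-d}$; $(i-1,i)$-entry $q^d-q^{2i-2-d}$. - $G_q(t)$: $(i,i)$-entry $q^{2i-d}$; $(i-1,i)$-entry $(q^d-q^{2i-2-d})(1-tq^{d-2i+1})$.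 - $L_q(t)$: $(i,i)$-entry $q^{2i-d}$; $(i-1,i)$-entry $(q^d-q^{2i-2-d})(1-tq^{d-2i+1})^{-1}$. - $S_q(t)$: $(i-1,i)$-entry $(q^d-q^{2i-d-2})(1-tq^{2i-d-1})$; $(i,i-1)$-entry $(q^{2i-d}-q^{-d})q^{2i-d-1}t$; $(i,i)$-entry $q^d-(q^{2i-d}-q^{-d})q^{2i-d-1}t-(q^d-q^{2i-d})(1-tq^{2i-d+1})$. For an integer $d\ge1$ and a nonzero $t\in\mathbb F$ not among $\{q^{d-2n+1}\}_{n=1}^d$, $\mathbf V_d(t)$ is the evaluation module for $\boxtimes_q$ having a basis with respect to which the standard generators are represented by: $x_{01}: ZS_{q^{-1}}(t^{-1})Z$, $x_{12}: E_q$, $x_{23}: K_q$, $x_{30}: ZG_{q^{-1}}(t)Z$, $x_{02}: L_q(t)$, $x_{13}: (ZE_{q^{-1}}Z)^{-1}$, $x_{20}: (L_q(t))^{-1}$, $x_{31}: ZE_{q^{-1}}Z$. Every evaluation module $V$ of diameter $d$ is isomorphic to $\mathbf V_d(t)$ for a unique such $t$, called the evaluation parameter of $V$. *)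

theory Defs
  imports
    "HOL-Library.Numeral_Type"
    "HOL-Computational_Algebra.Polynomial"
    "Jordan_Normal_Form.Gauss_Jordan_Elimination"
begin

text \<open>The index set is the ring of integers modulo 4, i.e. the numeral type 4.
  Vector spaces are given by an arbitrary scalar multiplication (locale
  \<^locale>\<open>vector_space\<close>), the space being the whole type.\<close>

type_synonym Z4 = "4"

definition std_index :: "Z4 \<Rightarrow> Z4 \<Rightarrow> bool" where
  "std_index i j \<longleftrightarrow> j - i = 1 \<or> j - i = 2"

definition qint :: "'f::field \<Rightarrow> int \<Rightarrow> 'f" where
  "qint q n = (q powi n - q powi (- n)) / (q - inverse q)"


section \<open>Modules for the q-tetrahedron algebra\<close>

text \<open>As the algebra is presented by generators and relations, a module structure on a vector
  space is a family of linear maps, one for each standard generator, satisfying the defining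
  relations. The values \<open>x i j\<close> at pairs that do not index a standard generator are never
  constrained and never used.\<close>

definition boxtimes_module ::
  "('f::field \<Rightarrow> 'v::ab_group_add \<Rightarrow> 'v) \<Rightarrow> 'f \<Rightarrow> (Z4 \<Rightarrow> Z4 \<Rightarrow> 'v \<Rightarrow> 'v) \<Rightarrow> bool" where
  "boxtimes_module scale q x \<longleftrightarrow>
     vector_space scale \<and>
     (\<forall>i j. std_index i j \<longrightarrow> Vector_Spaces.linear scale scale (x i j)) \<and>
     (\<forall>i j. j - i = 2 \<longrightarrow> (\<forall>v. x i j (x j i v) = v)) \<and>
     (\<forall>i j k. (j - i, k - j) \<in> {(1, 1), (1, 2), (2, 1)} \<longrightarrow>
        (\<forall>v. scale (inverse (q - inverse q))
               (scale q (x i j (x j k v)) - scale (inverse q) (x j k (x i j v))) = v)) \<and>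
     (\<forall>i j k l. j - i = 1 \<and> k - j = 1 \<and> l - k = 1 \<longrightarrow>
        (\<forall>v. (x i j ^^ 3) (x k l v)
             - scale (qint q 3) ((x i j ^^ 2) (x k l (x i j v)))
             + scale (qint q 3) (x i j (x k l ((x i j ^^ 2) v)))
             - x k l ((x i j ^^ 3) v) = 0))"

definition finite_dim :: "('f::field \<Rightarrow> 'v::ab_group_add \<Rightarrow> 'v) \<Rightarrow> bool" where
  "finite_dim scale \<longleftrightarrow> (\<exists>B. finite B \<and> Modules.module.span scale B = UNIV)"

definition irreducible_module ::
  "('f::field \<Rightarrow> 'v::ab_group_add \<Rightarrow> 'v) \<Rightarrow> (Z4 \<Rightarrow> Z4 \<Rightarrow> 'v \<Rightarrow> 'v) \<Rightarrow> bool" where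
  "irreducible_module scale x \<longleftrightarrow>
     (UNIV :: 'v set) \<noteq> {0} \<and>
     (\<forall>W. Modules.module.subspace scale W \<and>
          (\<forall>i j. std_index i j \<longrightarrow> x i j ` W \<subseteq> W) \<longrightarrow> W = {0} \<or> W = UNIV)"

definition trivial_module ::
  "('f::field \<Rightarrow> 'v::ab_group_add \<Rightarrow> 'v) \<Rightarrow> (Z4 \<Rightarrow> Z4 \<Rightarrow> 'v \<Rightarrow> 'v) \<Rightarrow> bool" where
  "trivial_module scale x \<longleftrightarrow>
     vector_space.dim scale (UNIV :: 'v set) = 1 \<and>
     (\<forall>i j. std_index i j \<longrightarrow> (\<forall>v. x i j v = v))"

definition eigenspace ::
  "('f::field \<Rightarrow> 'v::ab_group_add \<Rightarrow> 'v) \<Rightarrow> ('v \<Rightarrow> 'v) \<Rightarrow> 'f \<Rightarrow> 'v set" where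
  "eigenspace scale A c = {v. A v = scale c v}"

definition eigenvalues ::
  "('f::field \<Rightarrow> 'v::ab_group_add \<Rightarrow> 'v) \<Rightarrow> ('v \<Rightarrow> 'v) \<Rightarrow> 'f set" where
  "eigenvalues scale A = {c. \<exists>v. v \<noteq> 0 \<and> A v = scale c v}"

definition diagonalizable ::
  "('f::field \<Rightarrow> 'v::ab_group_add \<Rightarrow> 'v) \<Rightarrow> ('v \<Rightarrow> 'v) \<Rightarrow> bool" where
  "diagonalizable scale A \<longleftrightarrow>
     (\<exists>B. \<not> Modules.module.dependent scale B \<and> Modules.module.span scale B = UNIV \<and>
          (\<forall>b\<in>B. \<exists>c. A b = scale c b))"

definition has_diameter_type ::
  "('f::field \<Rightarrow> 'v::ab_group_add \<Rightarrow> 'v) \<Rightarrow> 'f \<Rightarrow> (Z4 \<Rightarrow> Z4 \<Rightarrow> 'v \<Rightarrow> 'v) \<Rightarrow> nat \<Rightarrow> 'f \<Rightarrow> bool" where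
  "has_diameter_type scale q x d \<epsilon> \<longleftrightarrow>
     \<epsilon> \<in> {1, -1} \<and>
     (\<forall>i j. std_index i j \<longrightarrow>
        diagonalizable scale (x i j) \<and>
        eigenvalues scale (x i j) = {\<epsilon> * q powi (int d - 2 * int n) | n. n \<le> d})"

text \<open>Component \<open>n\<close> (for \<open>n \<le> d\<close>) of the decomposition \<open>[i,j]\<close> of a module of type 1 and
  diameter \<open>d\<close>, for distinct \<open>i\<close>, \<open>j\<close>. The second branch is the case \<open>j - i = 3\<close>.\<close>

definition decomp ::
  "('f::field \<Rightarrow> 'v::ab_group_add \<Rightarrow> 'v) \<Rightarrow> 'f \<Rightarrow> (Z4 \<Rightarrow> Z4 \<Rightarrow> 'v \<Rightarrow> 'v) \<Rightarrow> nat \<Rightarrow>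
     Z4 \<Rightarrow> Z4 \<Rightarrow> nat \<Rightarrow> 'v set" where
  "decomp scale q x d i j n =
     (if std_index i j then eigenspace scale (x i j) (q powi (int d - 2 * int n))
      else eigenspace scale (x j i) (q powi (int d - 2 * int (d - n))))"

definition has_shape ::
  "('f::field \<Rightarrow> 'v::ab_group_add \<Rightarrow> 'v) \<Rightarrow> 'f \<Rightarrow> (Z4 \<Rightarrow> Z4 \<Rightarrow> 'v \<Rightarrow> 'v) \<Rightarrow> nat \<Rightarrow>
     (nat \<Rightarrow> nat) \<Rightarrow> bool" where
  "has_shape scale q x d \<rho> \<longleftrightarrow>
     (\<forall>i j n. i \<noteq> j \<and> n \<le> d \<longrightarrow> vector_space.dim scale (decomp scale q x d i j n) = \<rho> n)"

text \<open>The flag \<open>[i]\<close> is induced by \<open>[i,j]\<close> for every \<open>j \<noteq> i\<close>; here \<open>j = i + 1\<close> is used.\<close>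

definition flag ::
  "('f::field \<Rightarrow> 'v::ab_group_add \<Rightarrow> 'v) \<Rightarrow> 'f \<Rightarrow> (Z4 \<Rightarrow> Z4 \<Rightarrow> 'v \<Rightarrow> 'v) \<Rightarrow> nat \<Rightarrow>
     Z4 \<Rightarrow> nat \<Rightarrow> 'v set" where
  "flag scale q x d i n =
     {\<Sum>m\<le>n. w m | w. \<forall>m\<le>n. w m \<in> decomp scale q x d i (i + 1) m}"

definition evaluation_module ::
  "('f::field \<Rightarrow> 'v::ab_group_add \<Rightarrow> 'v) \<Rightarrow> 'f \<Rightarrow> (Z4 \<Rightarrow> Z4 \<Rightarrow> 'v \<Rightarrow> 'v) \<Rightarrow> nat \<Rightarrow> bool" where
  "evaluation_module scale q x d \<longleftrightarrow>
     boxtimes_module scale q x \<and> finite_dim scale \<and> irreducible_module scale x \<and>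
     \<not> trivial_module scale x \<and>
     has_diameter_type scale q x d 1 \<and> has_shape scale q x d (\<lambda>_. 1)"


section \<open>The dual space\<close>

text \<open>The pairing \<open>(u, f)\<close> is \<open>f u\<close>.\<close>

definition dual_space :: "('f::field \<Rightarrow> 'v::ab_group_add \<Rightarrow> 'v) \<Rightarrow> ('v \<Rightarrow> 'f) set" where
  "dual_space scale = {f. Vector_Spaces.linear scale (*) f}"

definition adjoint_map :: "('v \<Rightarrow> 'v) \<Rightarrow> ('v \<Rightarrow> 'f) \<Rightarrow> ('v \<Rightarrow> 'f)" where
  "adjoint_map A f = (\<lambda>u. f (A u))"

definition dual_eigenspace ::
  "('f::field \<Rightarrow> 'v::ab_group_add \<Rightarrow> 'v) \<Rightarrow> ('v \<Rightarrow> 'v) \<Rightarrow> 'f \<Rightarrow> ('v \<Rightarrow> 'f) set" where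
  "dual_eigenspace scale A c = {f \<in> dual_space scale. adjoint_map A f = (\<lambda>u. c * f u)}"

definition dual_decomp ::
  "('f::field \<Rightarrow> 'v::ab_group_add \<Rightarrow> 'v) \<Rightarrow> 'f \<Rightarrow> (Z4 \<Rightarrow> Z4 \<Rightarrow> 'v \<Rightarrow> 'v) \<Rightarrow> nat \<Rightarrow>
     Z4 \<Rightarrow> Z4 \<Rightarrow> nat \<Rightarrow> ('v \<Rightarrow> 'f) set" where
  "dual_decomp scale q x d i j n =
     (if std_index i j then dual_eigenspace scale (x i j) (q powi (2 * int n - int d))
      else dual_eigenspace scale (x j i) (q powi (2 * int (d - n) - int d)))"

definition dual_flag ::
  "('f::field \<Rightarrow> 'v::ab_group_add \<Rightarrow> 'v) \<Rightarrow> 'f \<Rightarrow> (Z4 \<Rightarrow> Z4 \<Rightarrow> 'v \<Rightarrow> 'v) \<Rightarrow> nat \<Rightarrow>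
     Z4 \<Rightarrow> nat \<Rightarrow> ('v \<Rightarrow> 'f) set" where
  "dual_flag scale q x d i n =
     {(\<lambda>u. \<Sum>m\<le>n. w m u) | w. \<forall>m\<le>n. w m \<in> dual_decomp scale q x d i (i + 1) m}"


section \<open>Bases and matrices\<close>

definition basis_seq ::
  "('f::field \<Rightarrow> 'v::ab_group_add \<Rightarrow> 'v) \<Rightarrow> nat \<Rightarrow> (nat \<Rightarrow> 'v) \<Rightarrow> bool" where
  "basis_seq scale d b \<longleftrightarrow>
     inj_on b {..d} \<and> \<not> Modules.module.dependent scale (b ` {..d}) \<and>
     Modules.module.span scale (b ` {..d}) = UNIV"

definition represents ::
  "('f::field \<Rightarrow> 'v::ab_group_add \<Rightarrow> 'v) \<Rightarrow> nat \<Rightarrow> (nat \<Rightarrow> 'v) \<Rightarrow> 'f mat \<Rightarrow> ('v \<Rightarrow> 'v) \<Rightarrow> bool" where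
  "represents scale d b M A \<longleftrightarrow> (\<forall>n\<le>d. A (b n) = (\<Sum>i\<le>d. scale (M $$ (i, n)) (b i)))"

text \<open>The superdiagonal entry at \<open>(i - 1, i)\<close> is written at row \<open>r\<close>, column \<open>c = Suc r\<close>,
  so that \<open>i = c\<close>; the subdiagonal entry at \<open>(i, i - 1)\<close> is at row \<open>r = Suc c\<close>, so that \<open>i = r\<close>.\<close>

definition Zmat :: "nat \<Rightarrow> 'f::field mat" where
  "Zmat d = mat (d + 1) (d + 1) (\<lambda>(r, c). if r + c = d then 1 else 0)"

definition Kmat :: "nat \<Rightarrow> 'f::field \<Rightarrow> 'f mat" where
  "Kmat d q = mat (d + 1) (d + 1) (\<lambda>(r, c). if r = c then q powi (int d - 2 * int r) else 0)"

definition Emat :: "nat \<Rightarrow> 'f::field \<Rightarrow> 'f mat" where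
  "Emat d q = mat (d + 1) (d + 1) (\<lambda>(r, c).
     if r = c then q powi (2 * int r - int d)
     else if c = Suc r then q ^ d - q powi (2 * int c - 2 - int d)
     else 0)"

definition Gmat :: "nat \<Rightarrow> 'f::field \<Rightarrow> 'f \<Rightarrow> 'f mat" where
  "Gmat d q t = mat (d + 1) (d + 1) (\<lambda>(r, c).
     if r = c then q powi (2 * int r - int d)
     else if c = Suc r then
       (q ^ d - q powi (2 * int c - 2 - int d)) * (1 - t * q powi (int d - 2 * int c + 1))
     else 0)"

definition Lmat :: "nat \<Rightarrow> 'f::field \<Rightarrow> 'f \<Rightarrow> 'f mat" where
  "Lmat d q t = mat (d + 1) (d + 1) (\<lambda>(r, c).
     if r = c then q powi (2 * int r - int d)
     else if c = Suc r then
       (q ^ d - q powi (2 * int c - 2 - int d)) * inverse (1 - t * q powi (int d - 2 * int c + 1))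
     else 0)"

definition Smat :: "nat \<Rightarrow> 'f::field \<Rightarrow> 'f \<Rightarrow> 'f mat" where
  "Smat d q t = mat (d + 1) (d + 1) (\<lambda>(r, c).
     if c = Suc r then
       (q ^ d - q powi (2 * int c - int d - 2)) * (1 - t * q powi (2 * int c - int d - 1))
     else if r = Suc c then
       (q powi (2 * int r - int d) - q powi (- int d)) * q powi (2 * int r - int d - 1) * t
     else if r = c then
       q ^ d
       - (q powi (2 * int r - int d) - q powi (- int d)) * q powi (2 * int r - int d - 1) * t
       - (q ^ d - q powi (2 * int r - int d)) * (1 - t * q powi (2 * int r - int d + 1))
     else 0)"

text \<open>The matrices to which \<open>matinv\<close> is applied are triangular with nonzero diagonal entries.\<close>

abbreviation matinv :: "'f::field mat \<Rightarrow> 'f mat" where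
  "matinv M \<equiv> the (mat_inverse M)"

text \<open>The module is isomorphic to the model with parameter \<open>t\<close>, i.e. it has a basis
  with respect to which the standard generators are represented by the matrices of the model.\<close>

definition evaluation_parameter ::
  "('f::field \<Rightarrow> 'v::ab_group_add \<Rightarrow> 'v) \<Rightarrow> 'f \<Rightarrow> (Z4 \<Rightarrow> Z4 \<Rightarrow> 'v \<Rightarrow> 'v) \<Rightarrow> nat \<Rightarrow> 'f \<Rightarrow> bool" where
  "evaluation_parameter scale q x d t \<longleftrightarrow>
     t \<noteq> 0 \<and> t \<notin> {q powi (int d - 2 * int n + 1) | n. 1 \<le> n \<and> n \<le> d} \<and>
     (\<exists>b. basis_seq scale d b \<and>
        represents scale d b (Zmat d * Smat d (inverse q) (inverse t) * Zmat d) (x 0 1) \<and>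
        represents scale d b (Emat d q) (x 1 2) \<and>
        represents scale d b (Kmat d q) (x 2 3) \<and>
        represents scale d b (Zmat d * Gmat d (inverse q) t * Zmat d) (x 3 0) \<and>
        represents scale d b (Lmat d q t) (x 0 2) \<and>
        represents scale d b (matinv (Zmat d * Emat d (inverse q) * Zmat d)) (x 1 3) \<and>
        represents scale d b (matinv (Lmat d q t)) (x 2 0) \<and>
        represents scale d b (Zmat d * Emat d (inverse q) * Zmat d) (x 3 1))"


section \<open>Normalized bases and exchangers\<close>

text \<open>The sequence \<open>u\<close> (of which only the values at \<open>0, \<dots>, d\<close> matter) is the basis
  \<open>[i,j,k,l]\<close> determined by the vectors \<open>\<eta>\<close>. The first index plays no role beyond being
  the one left over.\<close>

definition normalized_basis ::
  "('f::field \<Rightarrow> 'v::ab_group_add \<Rightarrow> 'v) \<Rightarrow> 'f \<Rightarrow> (Z4 \<Rightarrow> Z4 \<Rightarrow> 'v \<Rightarrow> 'v) \<Rightarrow> nat \<Rightarrow>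
     (Z4 \<Rightarrow> 'v) \<Rightarrow> Z4 \<Rightarrow> Z4 \<Rightarrow> Z4 \<Rightarrow> Z4 \<Rightarrow> (nat \<Rightarrow> 'v) \<Rightarrow> bool" where
  "normalized_basis scale q x d \<eta> i j k l u \<longleftrightarrow>
     distinct [i, j, k, l] \<and>
     basis_seq scale d u \<and>
     (\<forall>n\<le>d. u n \<in> decomp scale q x d k l n) \<and>
     \<eta> j = (\<Sum>n\<le>d. u n)"

definition exchanger ::
  "('f::field \<Rightarrow> 'v::ab_group_add \<Rightarrow> 'v) \<Rightarrow> (Z4 \<Rightarrow> Z4 \<Rightarrow> 'v \<Rightarrow> 'v) \<Rightarrow> ('v \<Rightarrow> 'v) \<Rightarrow> bool" where
  "exchanger scale x X \<longleftrightarrow>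
     Vector_Spaces.linear scale scale X \<and> bij X \<and>
     (\<forall>i j. std_index i j \<longrightarrow> X \<circ> x i j \<circ> inv_into UNIV X = x (i + 2) (j + 2))"

text \<open>This does not depend on the choice of \<open>\<eta>\<close>: rescaling \<open>\<eta> 2\<close> rescales the
  whole basis \<open>[0,2,1,3]\<close>.\<close>

definition standard_exchanger ::
  "('f::field \<Rightarrow> 'v::ab_group_add \<Rightarrow> 'v) \<Rightarrow> 'f \<Rightarrow> (Z4 \<Rightarrow> Z4 \<Rightarrow> 'v \<Rightarrow> 'v) \<Rightarrow> nat \<Rightarrow> 'f \<Rightarrow>
     (Z4 \<Rightarrow> 'v) \<Rightarrow> ('v \<Rightarrow> 'v) \<Rightarrow> bool" where
  "standard_exchanger scale q x d t \<eta> X \<longleftrightarrow>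
     exchanger scale x X \<and>
     (\<exists>b. normalized_basis scale q x d \<eta> 0 2 1 3 b \<and>
        represents scale d b
          (mat (d + 1) (d + 1) (\<lambda>(i, j).
             if i + j = d then t ^ i * q powi (int i * (int d - 1) - int (d choose 2)) else 0))
          X)"

definition sends_to_multiple ::
  "('f::field \<Rightarrow> 'v::ab_group_add \<Rightarrow> 'v) \<Rightarrow> nat \<Rightarrow> ('v \<Rightarrow> 'v) \<Rightarrow> (nat \<Rightarrow> 'v) \<Rightarrow> 'f \<Rightarrow>
     (nat \<Rightarrow> 'v) \<Rightarrow> bool" where
  "sends_to_multiple scale d X u \<alpha> v \<longleftrightarrow> (\<forall>n\<le>d. X (u n) = scale \<alpha> (v n))"

end

theory Submission
  imports Defs
begin

text \<open>
  An exchanger \<open>X\<close> carries component \<open>n\<close> of the decomposition \<open>[k,l]\<close> onto component \<open>n\<close> of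
  \<open>[k+2,l+2]\<close>. Component 0 of each flag is a line, so \<open>X (\<eta> j) = c \<cdot> \<eta> (j + 2)\<close> for some \<open>c\<close>, and
  comparing components in \<open>\<eta> j = \<Sum>n. u n\<close> and \<open>\<eta> (j + 2) = \<Sum>n. v n\<close> shows that \<open>X\<close> sends every
  \<open>u n\<close> to \<open>c \<cdot> v n\<close> with this same \<open>c\<close> (lemma \<open>exchanger_normalized_basis\<close>). Hence the scalar
  depends on \<open>j\<close> alone, and four numbers are left to be found.

  To find them, \<open>X (\<eta> j)\<close> is paired with a vector \<open>f\<close> spanning component 0 of a dual flag. The
  pairings are computed in the basis \<open>b = [0,2,1,3]\<close>, in which \<open>X\<close> is antidiagonal. Two facts on
  extreme eigenvalues say how the flags sit with respect to \<open>b\<close>. If \<open>x i j\<close> and \<open>x j k\<close> satisfy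
  the q-Weyl relation, an eigenvector of one of them for eigenvalue \<open>c\<close> is, up to an error term,
  an eigenvector of the other for \<open>inverse c\<close>; the error term is an eigenvector of the former for
  \<open>q\<^sup>2 * c\<close> or \<open>inverse (q\<^sup>2) * c\<close>, so it vanishes when this value lies outside the spectrum
  (\<open>extreme_eigenvector\<close>, and \<open>extreme_left_eigenvector\<close> for functionals). It follows that
  \<open>\<eta> 1\<close> and \<open>\<eta> 3\<close> are multiples of \<open>b 0\<close> and \<open>b d\<close>, that \<open>\<eta>' 1\<close> sees only \<open>b d\<close>, and that \<open>\<eta>' 3\<close>
  sees only \<open>b 0\<close>.

  For even \<open>j\<close> this suffices: only one term of \<open>\<eta> 2 = \<Sum>n. b n\<close> contributes to a pairing with
  \<open>\<eta>' 1\<close> or \<open>\<eta>' 3\<close>, and \<open>X \<circ> X\<close> is the scalar \<open>t ^ d\<close>. For odd \<open>j\<close> the ratio between the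
  values of \<open>\<eta>' 2\<close> at \<open>b 0\<close> and at \<open>b d\<close> is needed. The normalization \<open>\<eta> 2 = \<Sum>n. b n\<close>
  determines the bidiagonal matrix of \<open>x 1 2\<close> in the basis \<open>b\<close>, so that being a left eigenvector of
  \<open>x 1 2\<close> turns into a two-term recurrence for the values of \<open>\<eta>' 2\<close>, whose product telescopes to
  \<open>(-1) ^ d * q powi (- d * (d - 1))\<close> (\<open>functional_ends\<close>). The functional \<open>\<eta>' 0 \<circ> X\<close> is again of
  the kind of \<open>\<eta>' 2\<close>, which settles the last case.
\<close>

section \<open>Linear algebra\<close>

context vector_space
begin

lemma dim_one_multiple:
  assumes "subspace E" and "dim E = 1" and "v \<in> E" and "v \<noteq> 0" and "w \<in> E"
  obtains c where "w = scale c v"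
proof -
  obtain B where "E \<subseteq> span B" and "card B = 1"
    using basis_exists[of E] assms(2) by metis
  then obtain b where "E \<subseteq> span {b}"
    by (auto simp: card_1_singleton_iff)
  then obtain k m where "v = scale k b" and "w = scale m b"
    using assms(3,5) span_singleton[of b] by blast
  with \<open>v \<noteq> 0\<close> have "w = scale (m / k) v"
    by auto
  then show thesis by (rule that)
qed

lemma basis_seq_nonzero:
  assumes "basis_seq scale d b" and "n \<le> d"
  shows "b n \<noteq> 0"
  using assms dependent_zero[of "b ` {..d}"] unfolding basis_seq_def
  by (metis atMost_iff image_eqI)

lemma basis_seq_coeffs_zero:
  assumes b: "basis_seq scale d b" and sum: "(\<Sum>n\<le>d. scale (a n) (b n)) = 0" and "n \<le> d"
  shows "a n = 0"
proof -
  have inj: "inj_on b {..d}" and ind: "independent (b ` {..d})"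
    using b by (auto simp: basis_seq_def)
  have "(\<Sum>v\<in>b ` {..d}. scale (a (the_inv_into {..d} b v)) v) = (\<Sum>n\<le>d. scale (a n) (b n))"
    by (subst sum.reindex[OF inj]) (auto intro!: sum.cong simp: the_inv_into_f_f[OF inj])
  then have "a (the_inv_into {..d} b (b n)) = 0"
    using independentD[OF ind, of "b ` {..d}" "\<lambda>v. a (the_inv_into {..d} b v)" "b n"] sum \<open>n \<le> d\<close>
    by auto
  then show ?thesis
    using the_inv_into_f_f[OF inj] \<open>n \<le> d\<close> by simp
qed

lemma basis_seq_coeffs_unique:
  assumes "basis_seq scale d b"
    and "(\<Sum>n\<le>d. scale (a n) (b n)) = (\<Sum>n\<le>d. scale (c n) (b n))" and "n \<le> d"
  shows "a n = c n"
  using basis_seq_coeffs_zero[of d b "\<lambda>n. a n - c n" n] assms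
  by (simp add: scale_left_diff_distrib sum_subtractf)

lemma
  assumes "f \<in> dual_space scale"
  shows functional_add: "f (v + w) = f v + f w"
    and functional_scale: "f (scale c v) = c * f v"
    and functional_sum: "f (sum g A) = (\<Sum>a\<in>A. f (g a))"
    and functional_zero: "f 0 = 0"
proof -
  have f: "module_hom scale (*) f"
    using assms by (simp add: dual_space_def linear_iff_module_hom)
  show "f (v + w) = f v + f w" by (rule module_hom.add[OF f])
  show "f (scale c v) = c * f v" by (rule module_hom.scale[OF f])
  show "f (sum g A) = (\<Sum>a\<in>A. f (g a))" by (rule module_hom.sum[OF f])
  show "f 0 = 0" by (rule module_hom.zero[OF f])
qed

lemmas functional_simps = functional_add functional_scale functional_sum functional_zero

lemma functional_zero_on_basis:
  assumes "f \<in> dual_space scale" and "span B = UNIV" and "\<And>v. v \<in> B \<Longrightarrow> f v = 0"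
  shows "f = (\<lambda>_. 0)"
proof
  fix v
  note f_simps = functional_simps[OF assms(1)]
  have "v \<in> span B" using assms(2) by simp
  then show "f v = 0"
    by (induction rule: span_induct_alt) (simp_all add: f_simps assms(3))
qed

end

lemma twice_choose_two: "int d * (int d - 1) = 2 * int (d choose 2)"
  by (induction d) (simp_all add: numeral_2_eq_2 algebra_simps)

text \<open>The sums of indices that arise from shifting by 2 are evaluated to these two numerals.\<close>

lemma Z4_reduce [simp]: "(4 :: Z4) = 0" "(5 :: Z4) = 1"
  by simp_all

lemma Z4_cases:
  fixes j :: Z4
  obtains "j = 0" | "j = 1" | "j = 2" | "j = 3"
proof (cases j)
  case (of_int z)
  then have "z = 0 \<or> z = 1 \<or> z = 2 \<or> z = 3" by auto
  then show thesis using of_int that by auto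
qed


section \<open>Extreme eigenvectors and the q-Weyl relation\<close>

text \<open>The index triples for which \<open>x i j\<close> and \<open>x j k\<close> satisfy the q-Weyl relation
  \<open>q * x i j * x j k - inverse q * x j k * x i j = q - inverse q\<close>.\<close>

definition triad :: "Z4 \<Rightarrow> Z4 \<Rightarrow> Z4 \<Rightarrow> bool" where
  "triad i j k \<longleftrightarrow> (j - i, k - j) \<in> {(1, 1), (1, 2), (2, 1)}"

locale eval_module = vector_space scale
  for scale :: "'f::field \<Rightarrow> 'v::ab_group_add \<Rightarrow> 'v" +
  fixes q :: 'f and x :: "Z4 \<Rightarrow> Z4 \<Rightarrow> 'v \<Rightarrow> 'v" and d :: nat
  assumes q_nonzero: "q \<noteq> 0" and q_not_root: "\<And>n::nat. n > 0 \<Longrightarrow> q ^ n \<noteq> 1"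
    and evaluation: "evaluation_module scale q x d"
begin

definition \<theta> :: "nat \<Rightarrow> 'f" where
  "\<theta> n = q powi (int d - 2 * int n)"

lemma q_powi_eq_one: "q powi m = 1 \<longleftrightarrow> m = 0"
proof
  assume *: "q powi m = 1"
  show "m = 0"
  proof (rule ccontr)
    assume "m \<noteq> 0"
    then have "nat \<bar>m\<bar> > 0" by simp
    moreover have "q ^ nat \<bar>m\<bar> = 1"
      using * q_nonzero by (cases "m \<ge> 0") (auto simp: power_int_def power_inverse)
    ultimately show False using q_not_root by blast
  qed
qed simp

lemma q_powi_eq_iff: "q powi m = q powi n \<longleftrightarrow> m = n"
proof -
  have "q powi m = q powi (m - n) * q powi n"
    using q_nonzero by (simp flip: power_int_add)
  then show ?thesis
    using q_powi_eq_one[of "m - n"] q_nonzero by auto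
qed

lemma theta_nonzero: "\<theta> n \<noteq> 0"
  using q_nonzero by (simp add: \<theta>_def)

lemma theta_eq_iff: "\<theta> m = \<theta> n \<longleftrightarrow> m = n"
  by (simp add: \<theta>_def q_powi_eq_iff)

lemma theta_Suc: "\<theta> n = q\<^sup>2 * \<theta> (Suc n)"
proof -
  have "q\<^sup>2 * \<theta> (Suc n) = q powi 2 * q powi (int d - 2 * int (Suc n))"
    by (simp add: \<theta>_def)
  also have "\<dots> = q powi (2 + (int d - 2 * int (Suc n)))"
    using q_nonzero by (simp only: power_int_add simp_thms)
  also have "2 + (int d - 2 * int (Suc n)) = int d - 2 * int n"
    by simp
  finally show ?thesis by (simp add: \<theta>_def)
qed

lemma theta_reflect: "n \<le> d \<Longrightarrow> \<theta> (d - n) = inverse (\<theta> n)"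
  by (simp add: \<theta>_def of_nat_diff power_int_minus[symmetric])

lemma theta_d: "\<theta> d = inverse (\<theta> 0)"
  using theta_reflect[of 0] by simp

lemma linear_x: "std_index i j \<Longrightarrow> Vector_Spaces.linear scale scale (x i j)"
  using evaluation by (simp add: evaluation_module_def boxtimes_module_def)

lemma x_add: "std_index i j \<Longrightarrow> x i j (v + w) = x i j v + x i j w"
  by (rule module_hom.add[of scale scale]) (simp add: linear_x flip: linear_iff_module_hom)

lemma x_diff: "std_index i j \<Longrightarrow> x i j (v - w) = x i j v - x i j w"
  by (rule module_hom.diff[of scale scale]) (simp add: linear_x flip: linear_iff_module_hom)

lemma x_scale: "std_index i j \<Longrightarrow> x i j (scale c v) = scale c (x i j v)"
  by (rule module_hom.scale) (simp add: linear_x flip: linear_iff_module_hom)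

lemma x_sum: "std_index i j \<Longrightarrow> x i j (sum g A) = (\<Sum>a\<in>A. x i j (g a))"
  by (rule module_hom.sum[of scale scale]) (simp add: linear_x flip: linear_iff_module_hom)

lemma x_inverse: "j - i = 2 \<Longrightarrow> x i j (x j i v) = v"
  using evaluation by (simp add: evaluation_module_def boxtimes_module_def)

lemma triad_std_index:
  assumes "triad i j k"
  shows "std_index i j" and "std_index j k"
  using assms by (auto simp: triad_def std_index_def)

text \<open>The q-Weyl relation solved for \<open>x i j \<circ> x j k\<close>, the form in which it acts on eigenvectors.\<close>

lemma q_relation:
  assumes "triad i j k"
  shows "x i j (x j k v) = scale (inverse (q\<^sup>2)) (x j k (x i j v)) + scale (1 - inverse (q\<^sup>2)) v"
proof -
  have ne: "q - inverse q \<noteq> 0"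
    using q_not_root[of 2] q_nonzero by (auto simp: field_simps power2_eq_square)
  have "scale (inverse (q - inverse q))
       (scale q (x i j (x j k v)) - scale (inverse q) (x j k (x i j v))) = v"
    using assms evaluation
    unfolding evaluation_module_def boxtimes_module_def triad_def by blast
  then have "scale (q - inverse q) (scale (inverse (q - inverse q))
       (scale q (x i j (x j k v)) - scale (inverse q) (x j k (x i j v)))) = scale (q - inverse q) v"
    by simp
  then have "scale q (x i j (x j k v)) - scale (inverse q) (x j k (x i j v)) = scale (q - inverse q) v"
    using ne by simp
  then have "scale q (x i j (x j k v)) = scale (inverse q) (x j k (x i j v)) + scale (q - inverse q) v"
    by (simp only: diff_eq_eq add.commute)
  then have "scale (inverse q) (scale q (x i j (x j k v)))
      = scale (inverse q) (scale (inverse q) (x j k (x i j v)) + scale (q - inverse q) v)"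
    by (simp only:)
  then show ?thesis
    using right_inverse[OF q_nonzero] left_inverse[OF q_nonzero]
    by (simp only: scale_scale scale_one scale_right_distrib right_diff_distrib power2_eq_square
        inverse_mult_distrib)
qed

lemma eigenvalue_is_theta:
  assumes "std_index i j" and "v \<noteq> 0" and "x i j v = scale c v"
  obtains n where "n \<le> d" and "c = \<theta> n"
proof -
  have "c \<in> eigenvalues scale (x i j)"
    using assms by (auto simp: eigenvalues_def)
  then show thesis
    using evaluation assms(1) that
    unfolding evaluation_module_def has_diameter_type_def by (auto simp: \<theta>_def)
qed

text \<open>The spectrum is a chain with ratio \<open>q\<^sup>2\<close>; this and the next lemma say that one step past either
  end leaves it, which is what forces error terms to vanish.\<close>

lemma beyond_theta_0: "n \<le> d \<Longrightarrow> q\<^sup>2 * \<theta> 0 \<noteq> \<theta> n"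
proof -
  have "q\<^sup>2 * \<theta> 0 = q powi (2 + int d)"
    using q_nonzero by (simp add: \<theta>_def power_int_add)
  then show "n \<le> d \<Longrightarrow> q\<^sup>2 * \<theta> 0 \<noteq> \<theta> n"
    by (simp add: \<theta>_def q_powi_eq_iff)
qed

lemma beyond_theta_d: "n \<le> d \<Longrightarrow> inverse (q\<^sup>2) * \<theta> d \<noteq> \<theta> n"
  using beyond_theta_0[of "d - n"] theta_reflect[of n] theta_d
  by (metis diff_le_self inverse_inverse_eq inverse_mult_distrib)

text \<open>The q-Weyl relation makes \<open>x i j\<close> act on an eigenvector of \<open>x j k\<close> as the inverse eigenvalue, up to
  a vector in a neighbouring eigenspace; the next lemma is the same with the roles exchanged.\<close>

lemma eigenvector_shift_up:
  assumes "triad i j k" and "x j k v = scale c v" and "c \<noteq> 0"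
  shows "x j k (x i j v - scale (inverse c) v) = scale (q\<^sup>2 * c) (x i j v - scale (inverse c) v)"
proof -
  have *: "scale c (x i j v) = scale (inverse (q\<^sup>2)) (x j k (x i j v)) + scale (1 - inverse (q\<^sup>2)) v"
    using q_relation[OF assms(1), of v] assms triad_std_index[OF assms(1)] by (simp add: x_scale)
  have "scale (q\<^sup>2) (scale c (x i j v)) = x j k (x i j v) + scale (q\<^sup>2 - 1) v"
    unfolding * using q_nonzero by (simp add: scale_right_distrib right_diff_distrib)
  then show ?thesis
    using assms triad_std_index[OF assms(1)]
    by (simp add: x_diff x_scale scale_right_diff_distrib scale_left_diff_distrib algebra_simps)
qed

lemma eigenvector_shift_down:
  assumes "triad i j k" and "x i j v = scale c v" and "c \<noteq> 0"
  shows "x i j (x j k v - scale (inverse c) v) = scale (inverse (q\<^sup>2) * c) (x j k v - scale (inverse c) v)"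
proof -
  have [simp]: "c * (inverse c * y) = y" for y
    using assms(3) by (simp flip: mult.assoc)
  then show ?thesis
    using q_relation[OF assms(1), of v] assms(2,3) triad_std_index[OF assms(1)]
    by (simp add: x_diff x_scale scale_right_diff_distrib scale_left_diff_distrib algebra_simps)
qed

text \<open>At an end of the spectrum the neighbouring eigenspace is missing, so the error term is zero.
  In terms of flags: component 0 of \<open>[j]\<close> is the same whether read off from \<open>[j,k]\<close> or from the
  inversion of \<open>[i,j]\<close>.\<close>

lemma extreme_eigenvector:
  assumes "triad i j k"
  shows "x i j v = scale (\<theta> d) v \<longleftrightarrow> x j k v = scale (\<theta> 0) v"
proof
  assume "x i j v = scale (\<theta> d) v"
  from eigenvector_shift_down[OF assms this theta_nonzero]
  have "x j k v - scale (inverse (\<theta> d)) v = 0"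
    using eigenvalue_is_theta[OF triad_std_index(1)[OF assms]] beyond_theta_d by metis
  then show "x j k v = scale (\<theta> 0) v"
    by (simp add: theta_d)
next
  assume "x j k v = scale (\<theta> 0) v"
  from eigenvector_shift_up[OF assms this theta_nonzero]
  have "x i j v - scale (inverse (\<theta> 0)) v = 0"
    using eigenvalue_is_theta[OF triad_std_index(2)[OF assms]] beyond_theta_0 by metis
  then show "x i j v = scale (\<theta> d) v"
    by (simp add: theta_d)
qed

text \<open>An eigenfunctional annihilates all eigenvectors for other eigenvalues, and by diagonalizability the
  eigenvectors span.\<close>

lemma left_eigenvector_zero:
  assumes "std_index i j" and f: "f \<in> dual_space scale"
    and eig: "\<And>v. f (x i j v) = c * f v"
    and vanish: "\<And>v. x i j v = scale c v \<Longrightarrow> f v = 0"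
  shows "f = (\<lambda>_. 0)"
proof -
  note f_simps = functional_simps[OF f]
  obtain B where B: "span B = UNIV" "\<And>b. b \<in> B \<Longrightarrow> \<exists>c. x i j b = scale c b"
    using evaluation assms(1)
    unfolding evaluation_module_def has_diameter_type_def diagonalizable_def by metis
  have "f b = 0" if "b \<in> B" for b
  proof -
    obtain a where a: "x i j b = scale a b" using B(2)[OF \<open>b \<in> B\<close>] by blast
    then have "a * f b = c * f b" using eig[of b] by (simp add: f_simps)
    then show ?thesis using a vanish by auto
  qed
  then show ?thesis using functional_zero_on_basis[OF f B(1)] by blast
qed

text \<open>The analogue for the dual flag \<open>[j]\<close>: the functional \<open>g = f \<circ> x i j - \<theta> 0 * f\<close> is an eigenfunctional
  of \<open>x j k\<close> for a value beyond the end of the spectrum.\<close>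

lemma extreme_left_eigenvector:
  assumes "triad i j k" and f: "f \<in> dual_space scale"
    and eig: "\<And>v. f (x j k v) = \<theta> d * f v"
  shows "f (x i j v) = \<theta> 0 * f v"
proof -
  note f_simps = functional_simps[OF f]
  note std = triad_std_index[OF assms(1)]
  define g where "g v = f (x i j v) - \<theta> 0 * f v" for v
  have "module_hom scale (*) g"
    unfolding module_hom_iff
  proof (intro conjI allI)
    show "g (a + b) = g a + g b" for a b
      unfolding g_def x_add[OF std(1)] f_simps by (simp add: ring_distribs)
    show "g (scale c a) = c * g a" for c a
      unfolding g_def x_scale[OF std(1)] f_simps by (simp add: right_diff_distrib mult.left_commute)
  qed (use f in \<open>simp_all add: dual_space_def linear_iff_module_hom module_hom_iff\<close>)
  then have g: "g \<in> dual_space scale"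
    by (simp add: dual_space_def linear_iff_module_hom)
  have "g (x j k v) = (inverse (q\<^sup>2) * \<theta> d) * g v" for v
  proof -
    have "f (x i j (x j k v)) = inverse (q\<^sup>2) * f (x j k (x i j v)) + (1 - inverse (q\<^sup>2)) * f v"
      by (simp only: q_relation[OF assms(1)] f_simps)
    moreover have [simp]: "\<theta> 0 * (inverse (\<theta> 0) * y) = y" for y
      using theta_nonzero[of 0] by (simp flip: mult.assoc)
    ultimately show ?thesis
      using theta_nonzero[of 0] by (simp add: g_def eig theta_d algebra_simps)
  qed
  moreover have "g v = 0" if "x j k v = scale (inverse (q\<^sup>2) * \<theta> d) v" for v
  proof -
    have "v = 0"
      using eigenvalue_is_theta[OF std(2) _ that] beyond_theta_d by metis
    then show ?thesis by (simp add: functional_simps[OF g])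
  qed
  ultimately have "g = (\<lambda>_. 0)"
    by (rule left_eigenvector_zero[OF std(2) g])
  then have "g v = 0" by simp
  then show ?thesis by (simp add: g_def)
qed

lemma subspace_decomp:
  assumes "i \<noteq> j"
  shows "subspace (decomp scale q x d i j n)"
proof -
  have "std_index i j \<or> std_index j i"
    using assms by (cases i rule: Z4_cases; cases j rule: Z4_cases) (simp_all add: std_index_def)
  moreover have "subspace (eigenspace scale (x i j) c)" if "std_index i j" for i j c
  proof -
    interpret X: Vector_Spaces.linear scale scale "x i j" by (rule linear_x[OF that])
    show ?thesis
      by (rule subspaceI)
        (auto simp: eigenspace_def X.zero X.add X.scale scale_right_distrib mult.commute)
  qed
  ultimately show ?thesis by (auto simp: decomp_def)
qed

lemma decomp_multiple:
  assumes "i \<noteq> j" and "n \<le> d" and "v \<in> decomp scale q x d i j n" and "v \<noteq> 0"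
    and "w \<in> decomp scale q x d i j n"
  obtains c where "w = scale c v"
proof -
  have "dim (decomp scale q x d i j n) = 1"
    using evaluation assms(1,2) by (simp add: evaluation_module_def has_shape_def)
  then show thesis
    using dim_one_multiple[OF subspace_decomp[OF assms(1)]] assms(3-5) that by blast
qed

lemma decomp_iff:
  "std_index i j \<Longrightarrow> v \<in> decomp scale q x d i j n \<longleftrightarrow> x i j v = scale (\<theta> n) v"
  by (simp add: decomp_def eigenspace_def \<theta>_def)

text \<open>Eigenspaces are lines, so a nonzero eigenfunctional cannot kill the eigenvector for its own
  eigenvalue without killing all eigenvectors.\<close>

lemma pairing_nonzero:
  assumes std: "std_index i j" and f: "f \<in> dual_space scale" "f \<noteq> (\<lambda>_. 0)"
    and eig: "\<And>v. f (x i j v) = \<theta> n * f v" and "n \<le> d"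
    and w: "x i j w = scale (\<theta> n) w" "w \<noteq> 0"
  shows "f w \<noteq> 0"
proof
  assume "f w = 0"
  have "f v = 0" if "x i j v = scale (\<theta> n) v" for v
  proof -
    have "i \<noteq> j" using std by (auto simp: std_index_def)
    then obtain c where "v = scale c w"
      using decomp_multiple[of i j n w v] \<open>x i j v = scale (\<theta> n) v\<close> w \<open>n \<le> d\<close> std by (auto simp: decomp_iff)
    then show ?thesis using \<open>f w = 0\<close> by (simp add: functional_simps[OF f(1)])
  qed
  then show False using left_eigenvector_zero[OF std f(1) eig] f(2) by blast
qed

lemma flag_0_iff: "v \<in> flag scale q x d i 0 \<longleftrightarrow> x i (i + 1) v = scale (\<theta> 0) v"
proof -
  have "flag scale q x d i 0 = decomp scale q x d i (i + 1) 0"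
    unfolding flag_def by auto
  then show ?thesis by (simp add: decomp_iff std_index_def)
qed

lemma dual_flag_0:
  assumes "f \<in> dual_flag scale q x d i 0"
  shows "f \<in> dual_space scale" and "f (x i (i + 1) v) = \<theta> d * f v"
proof -
  have "f \<in> dual_decomp scale q x d i (i + 1) 0"
    using assms unfolding dual_flag_def by auto
  then show "f \<in> dual_space scale" and "f (x i (i + 1) v) = \<theta> d * f v"
    by (auto simp: dual_decomp_def dual_eigenspace_def adjoint_map_def std_index_def \<theta>_def fun_eq_iff)
qed

text \<open>This and the next lemma make the denominators in the theorem nonzero: the vector and the
  functional are both eigenvectors of the generator between the two indices, for the same eigenvalue.\<close>

lemma pairing_next_nonzero:
  assumes v: "v \<in> flag scale q x d (i + 1) 0" "v \<noteq> 0"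
    and f: "f \<in> dual_flag scale q x d i 0" "f \<noteq> (\<lambda>_. 0)"
  shows "f v \<noteq> 0"
proof (rule pairing_nonzero)
  have "triad i (i + 1) (i + 1 + 1)" by (simp add: triad_def)
  then show "x i (i + 1) v = scale (\<theta> d) v"
    using extreme_eigenvector v(1) by (simp add: flag_0_iff)
qed (use assms dual_flag_0[OF f(1)] in \<open>auto simp: std_index_def\<close>)

lemma pairing_previous_nonzero:
  assumes v: "v \<in> flag scale q x d i 0" "v \<noteq> 0"
    and f: "f \<in> dual_flag scale q x d (i + 1) 0" "f \<noteq> (\<lambda>_. 0)"
  shows "f v \<noteq> 0"
proof (rule pairing_nonzero)
  have "triad i (i + 1) (i + 1 + 1)" by (simp add: triad_def)
  then show "f (x i (i + 1) w) = \<theta> 0 * f w" for w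
    by (rule extreme_left_eigenvector) (use dual_flag_0[OF f(1)] in auto)
qed (use assms dual_flag_0[OF f(1)] in \<open>auto simp: std_index_def flag_0_iff\<close>)

end


section \<open>Eigenbases of the generator \<open>x 1 3\<close>\<close>

text \<open>Such a \<open>b\<close> is the basis \<open>[0,2,1,3]\<close> or \<open>[2,0,1,3]\<close>, or any other choice of scaling along the
  decomposition \<open>[1,3]\<close>.\<close>

locale basis_1_3 = eval_module +
  fixes b :: "nat \<Rightarrow> 'b"
  assumes basis: "basis_seq scale d b"
    and x13_b: "\<And>n. n \<le> d \<Longrightarrow> x 1 3 (b n) = scale (\<theta> n) (b n)"
begin

lemma triads: "triad 3 1 2" "triad 1 3 0" "triad 1 2 3"
  by (simp_all add: triad_def)

lemma std_indices: "std_index 1 3" "std_index 3 1" "std_index 1 2" "std_index 3 0" "std_index 2 3"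
  by (simp_all add: std_index_def)

lemma x31_b:
  assumes "n \<le> d"
  shows "x 3 1 (b n) = scale (inverse (\<theta> n)) (b n)"
proof -
  have "scale (\<theta> n) (x 3 1 (b n)) = b n"
    using x_inverse[of 1 3 "b n"] x13_b[OF assms] by (simp add: x_scale std_indices)
  then show ?thesis
    using theta_nonzero[of n] by (metis left_inverse scale_one scale_scale)
qed

text \<open>The vector \<open>b 0\<close> is extreme for \<open>x 3 1\<close>, hence for \<open>x 1 2\<close>: it spans component 0 of the flag \<open>[1]\<close>.
  Likewise \<open>b d\<close> spans component 0 of \<open>[3]\<close>.\<close>

lemma x12_b_0: "x 1 2 (b 0) = scale (\<theta> 0) (b 0)"
  using extreme_eigenvector[OF triads(1), of "b 0"] x31_b[of 0] by (simp add: theta_d)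

lemma multiple_of_first:
  assumes "x 1 2 w = scale (\<theta> 0) w"
  obtains \<alpha> where "w = scale \<alpha> (b 0)"
  using decomp_multiple[of 1 2 0 "b 0" w] basis_seq_nonzero[OF basis, of 0] x12_b_0 assms that
  by (auto simp: decomp_iff std_indices)

lemma multiple_of_last:
  assumes "x 3 0 w = scale (\<theta> 0) w"
  obtains \<alpha> where "w = scale \<alpha> (b d)"
proof -
  have "x 3 0 (b d) = scale (\<theta> 0) (b d)"
    using extreme_eigenvector[OF triads(2), of "b d"] x13_b[of d] by simp
  then show thesis
    using decomp_multiple[of 3 0 0 "b d" w] basis_seq_nonzero[OF basis, of d] assms that
    by (auto simp: decomp_iff std_indices)
qed

text \<open>A functional from component 0 of the dual flag \<open>[1]\<close> is also an eigenfunctional of \<open>x 3 1\<close>, and it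
  shares its eigenvalue with \<open>b d\<close> alone. Likewise for the dual flag \<open>[3]\<close> and \<open>b 0\<close>.\<close>

lemma functional_concentrated_last:
  assumes f: "f \<in> dual_space scale" and eig: "\<And>v. f (x 1 2 v) = \<theta> d * f v" and "n < d"
  shows "f (b n) = 0"
proof -
  note f_simps = functional_simps[OF f]
  have "inverse (\<theta> n) * f (b n) = \<theta> 0 * f (b n)"
    using extreme_left_eigenvector[OF triads(1) f, OF eig, of "b n"] x31_b[of n] \<open>n < d\<close>
    by (simp add: f_simps)
  moreover have "inverse (\<theta> n) \<noteq> \<theta> 0"
    using \<open>n < d\<close> by (simp add: theta_eq_iff flip: theta_reflect)
  ultimately show ?thesis by simp
qed

lemma functional_concentrated_first:
  assumes f: "f \<in> dual_space scale" and eig: "\<And>v. f (x 3 0 v) = \<theta> d * f v"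
    and "0 < n" and "n \<le> d"
  shows "f (b n) = 0"
proof -
  note f_simps = functional_simps[OF f]
  have "\<theta> n * f (b n) = \<theta> 0 * f (b n)"
    using extreme_left_eigenvector[OF triads(2) f, OF eig, of "b n"] x13_b[of n] \<open>n \<le> d\<close>
    by (simp add: f_simps)
  then show ?thesis
    using \<open>0 < n\<close> by (simp add: theta_eq_iff)
qed

text \<open>The error term in the action of \<open>x 1 2\<close> on \<open>b (Suc n)\<close> lies in the neighbouring eigenspace, the line
  of \<open>b n\<close>: the matrix of \<open>x 1 2\<close> is upper bidiagonal.\<close>

lemma x12_b_Suc:
  assumes "n < d"
  shows "\<exists>e. x 1 2 (b (Suc n)) = scale (\<theta> (Suc n)) (b (Suc n)) + scale e (b n)"
proof -
  define w where "w = x 1 2 (b (Suc n)) - scale (\<theta> (Suc n)) (b (Suc n))"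
  have "x 3 1 w = scale (inverse (\<theta> n)) w"
    using eigenvector_shift_down[OF triads(1) x31_b[of "Suc n"]] assms
      nonzero_imp_inverse_nonzero[OF theta_nonzero]
    by (simp add: w_def theta_Suc[of n])
  then have "w = scale (inverse (\<theta> n)) (x 1 3 w)"
    using x_inverse[of 3 1 w] by (simp add: x_scale std_indices)
  then have "x 1 3 w = scale (\<theta> n) w"
    using theta_nonzero[of n] by (metis right_inverse scale_one scale_scale)
  then obtain e where "w = scale e (b n)"
    using decomp_multiple[of 1 3 n "b n" w] basis_seq_nonzero[OF basis, of n] x13_b[of n] assms
    by (auto simp: decomp_iff std_indices)
  then have "x 1 2 (b (Suc n)) = scale (\<theta> (Suc n)) (b (Suc n)) + scale e (b n)"
    by (simp add: w_def algebra_simps)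
  then show ?thesis ..
qed

text \<open>When the sum of the basis is extreme for \<open>x 2 3\<close>, it is an eigenvector of \<open>x 1 2\<close> for \<open>\<theta> d\<close>: all
  rows of the bidiagonal matrix sum to \<open>\<theta> d\<close>, which determines the entries above the diagonal.\<close>

lemma x12_b:
  assumes w: "x 2 3 (\<Sum>n\<le>d. b n) = scale (\<theta> 0) (\<Sum>n\<le>d. b n)" and "n < d"
  shows "x 1 2 (b (Suc n)) = scale (\<theta> (Suc n)) (b (Suc n)) + scale (\<theta> d - \<theta> n) (b n)"
proof -
  have "\<exists>e. \<forall>n<d. x 1 2 (b (Suc n)) = scale (\<theta> (Suc n)) (b (Suc n)) + scale (e n) (b n)"
    using x12_b_Suc by metis
  then obtain e where
    e: "\<And>n. n < d \<Longrightarrow> x 1 2 (b (Suc n)) = scale (\<theta> (Suc n)) (b (Suc n)) + scale (e n) (b n)"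
    by blast
  have "(\<Sum>n\<le>d. scale (\<theta> d) (b n)) = x 1 2 (\<Sum>n\<le>d. b n)"
    unfolding iffD2[OF extreme_eigenvector[OF triads(3)] w] by (rule scale_sum_right[symmetric])
  also have "\<dots> = x 1 2 (b 0) + (\<Sum>n<d. x 1 2 (b (Suc n)))"
    by (simp only: sum.atMost_shift x_add[OF std_indices(3)] x_sum[OF std_indices(3)])
  also have "\<dots> = scale (\<theta> 0) (b 0) + (\<Sum>n<d. scale (\<theta> (Suc n)) (b (Suc n))) + (\<Sum>n<d. scale (e n) (b n))"
    by (simp add: x12_b_0 e sum.distrib algebra_simps)
  also have "(\<Sum>n<d. scale (e n) (b n)) = (\<Sum>n\<le>d. scale (if n < d then e n else 0) (b n))"
    by (simp flip: lessThan_Suc_atMost)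
  also have "scale (\<theta> 0) (b 0) + (\<Sum>n<d. scale (\<theta> (Suc n)) (b (Suc n))) = (\<Sum>n\<le>d. scale (\<theta> n) (b n))"
    by (simp only: sum.atMost_shift)
  also have "(\<Sum>n\<le>d. scale (\<theta> n) (b n)) + (\<Sum>n\<le>d. scale (if n < d then e n else 0) (b n))
      = (\<Sum>n\<le>d. scale (\<theta> n + (if n < d then e n else 0)) (b n))"
    by (simp add: scale_left_distrib sum.distrib)
  finally have "\<theta> d = \<theta> n + (if n < d then e n else 0)"
    by (rule basis_seq_coeffs_unique[OF basis]) (use \<open>n < d\<close> in simp)
  then have "e n = \<theta> d - \<theta> n" using \<open>n < d\<close> by simp
  then show ?thesis using e[OF \<open>n < d\<close>] by simp
qed

lemma prod_minus_q_powers: "(\<Prod>n<m. - (q powi (- 2 * int n))) = (- 1) ^ m * q powi (- 2 * int (m choose 2))"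
proof (induction m)
  case (Suc m)
  have "Suc m choose 2 = (m choose 2) + m"
    by (simp add: numeral_2_eq_2)
  then have "q powi (- 2 * int (Suc m choose 2)) = q powi (- 2 * int (m choose 2)) * q powi (- 2 * int m)"
    using q_nonzero by (simp add: ring_distribs flip: power_int_add)
  then show ?case using Suc by simp
qed (simp add: numeral_2_eq_2)

text \<open>The functional \<open>f\<close> is extreme for \<open>x 2 3\<close>, hence an eigenfunctional of \<open>x 1 2\<close>, whose bidiagonal matrix
  turns this into a two-term recurrence for \<open>f (b n)\<close>. The two families of coefficients coincide up
  to the order of the indices, signs and powers of \<open>q\<close>, so the q-factorials cancel between \<open>b 0\<close> and \<open>b d\<close>.\<close>

lemma functional_ends:
  assumes w: "x 2 3 (\<Sum>n\<le>d. b n) = scale (\<theta> 0) (\<Sum>n\<le>d. b n)"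
    and f: "f \<in> dual_space scale" and eig: "\<And>v. f (x 2 3 v) = \<theta> d * f v"
  shows "f (b d) = (- 1) ^ d * q powi (- 2 * int (d choose 2)) * f (b 0)"
proof -
  note f_simps = functional_simps[OF f]
  have rec: "(\<theta> 0 - \<theta> (Suc n)) * f (b (Suc n)) = (\<theta> d - \<theta> n) * f (b n)" if "n < d" for n
  proof -
    have "\<theta> 0 * f (b (Suc n)) = f (x 1 2 (b (Suc n)))"
      using extreme_left_eigenvector[OF triads(3) f, OF eig] by simp
    also have "\<dots> = \<theta> (Suc n) * f (b (Suc n)) + (\<theta> d - \<theta> n) * f (b n)"
      by (simp only: x12_b[OF w that] f_simps)
    finally show ?thesis by (simp add: left_diff_distrib)
  qed
  have "m \<le> d \<Longrightarrow> (\<Prod>n<m. \<theta> 0 - \<theta> (Suc n)) * f (b m) = (\<Prod>n<m. \<theta> d - \<theta> n) * f (b 0)" for m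
  proof (induction m)
    case (Suc m)
    have "(\<Prod>n<Suc m. \<theta> 0 - \<theta> (Suc n)) * f (b (Suc m))
        = (\<Prod>n<m. \<theta> 0 - \<theta> (Suc n)) * ((\<theta> 0 - \<theta> (Suc m)) * f (b (Suc m)))"
      by (simp only: prod.lessThan_Suc mult.assoc)
    also have "\<dots> = (\<theta> d - \<theta> m) * ((\<Prod>n<m. \<theta> 0 - \<theta> (Suc n)) * f (b m))"
      using rec[of m] Suc.prems by simp
    also have "\<dots> = (\<Prod>n<Suc m. \<theta> d - \<theta> n) * f (b 0)"
      using Suc by simp
    finally show ?case .
  qed simp
  then have ends: "(\<Prod>n<d. \<theta> 0 - \<theta> (Suc n)) * f (b d) = (\<Prod>n<d. \<theta> d - \<theta> n) * f (b 0)"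
    by simp
  \<comment> \<open>reversing the index, \<open>n\<close> to \<open>d - n\<close>, matches the coefficients on the two sides\<close>
  have factor: "\<theta> d - \<theta> n = - (q powi (- 2 * int n)) * (\<theta> 0 - \<theta> (Suc (d - Suc n)))" if "n < d" for n
  proof -
    have "q powi (- 2 * int n) * \<theta> 0 = \<theta> n"
      unfolding \<theta>_def using q_nonzero by (subst power_int_add[symmetric]) simp_all
    moreover have "q powi (- 2 * int n) * \<theta> (d - n) = \<theta> d"
      unfolding \<theta>_def using q_nonzero that
      by (subst power_int_add[symmetric]) (simp_all add: of_nat_diff)
    ultimately show ?thesis
      using that by (simp add: Suc_diff_Suc right_diff_distrib)
  qed
  have "(\<Prod>n<d. \<theta> d - \<theta> n)
      = (\<Prod>n<d. - (q powi (- 2 * int n))) * (\<Prod>n<d. \<theta> 0 - \<theta> (Suc (d - Suc n)))"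
    unfolding prod.distrib[symmetric] by (rule prod.cong) (use factor in simp_all)
  also have "(\<Prod>n<d. \<theta> 0 - \<theta> (Suc (d - Suc n))) = (\<Prod>n<d. \<theta> 0 - \<theta> (Suc n))"
    by (rule prod.nat_diff_reindex)
  finally have "(\<Prod>n<d. \<theta> 0 - \<theta> (Suc n)) * f (b d)
      = (\<Prod>n<d. \<theta> 0 - \<theta> (Suc n)) * ((\<Prod>n<d. - (q powi (- 2 * int n))) * f (b 0))"
    unfolding ends by simp
  moreover have "(\<Prod>n<d. \<theta> 0 - \<theta> (Suc n)) \<noteq> 0"
    by (simp add: theta_eq_iff)
  ultimately show ?thesis
    unfolding prod_minus_q_powers by (simp only: mult_cancel_left simp_thms)
qed

end



section \<open>Exchangers\<close>

context eval_module
begin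

lemma functional_comp_exchanger:
  assumes f: "f \<in> dual_space scale" and X: "Vector_Spaces.linear scale scale X"
  shows "(\<lambda>v. f (X v)) \<in> dual_space scale"
  using Vector_Spaces.linear_compose[OF X, of "(*)" f] f by (simp add: dual_space_def comp_def)

lemma exchanger_eq:
  assumes "exchanger scale x X" and "std_index i j"
  shows "X (x i j v) = x (i + 2) (j + 2) (X v)"
proof -
  have "(X \<circ> x i j \<circ> inv_into UNIV X) (X v) = x (i + 2) (j + 2) (X v)"
    using assms by (simp add: exchanger_def)
  moreover have "inj X" using assms(1) by (simp add: exchanger_def bij_is_inj)
  ultimately show ?thesis by simp
qed

lemma exchanger_decomp:
  assumes X: "exchanger scale x X" and "i \<noteq> j" and "v \<in> decomp scale q x d i j n"
  shows "X v \<in> decomp scale q x d (i + 2) (j + 2) n"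
proof -
  interpret X: Vector_Spaces.linear scale scale X
    using X by (simp add: exchanger_def)
  have "std_index i j \<or> std_index j i"
    using assms(2) by (cases i rule: Z4_cases; cases j rule: Z4_cases) (simp_all add: std_index_def)
  moreover have "std_index (i + 2) (j + 2) \<longleftrightarrow> std_index i j"
    by (simp add: std_index_def)
  moreover have "X v \<in> eigenspace scale (x (i + 2) (j + 2)) c"
    if "std_index i j" and "v \<in> eigenspace scale (x i j) c" for i j c
    using that(2) X.scale[of c v]
    unfolding eigenspace_def mem_Collect_eq exchanger_eq[OF X that(1), symmetric] by simp
  ultimately show ?thesis
    using assms(3) unfolding decomp_def by metis
qed

text \<open>Both \<open>X (u n)\<close> and \<open>v n\<close> lie on the same line, so \<open>X (u n) = a n \<cdot> v n\<close>; summing over \<open>n\<close> and comparing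
  with \<open>c \<cdot> \<eta> (j + 2) = \<Sum>n. c \<cdot> v n\<close> gives \<open>a n = c\<close>.\<close>

lemma exchanger_normalized_basis:
  assumes X: "exchanger scale x X"
    and u: "normalized_basis scale q x d \<eta> i j k l u"
    and v: "normalized_basis scale q x d \<eta> (i + 2) (j + 2) (k + 2) (l + 2) v"
    and c: "X (\<eta> j) = scale c (\<eta> (j + 2))"
  shows "sends_to_multiple scale d X u c v"
proof -
  interpret X: Vector_Spaces.linear scale scale X
    using X by (simp add: exchanger_def)
  have basis: "basis_seq scale d v" and kl: "k + 2 \<noteq> l + 2" "k \<noteq> l"
    using u v by (auto simp: normalized_basis_def)
  have "\<exists>a. \<forall>n\<le>d. X (u n) = scale (a n) (v n)"
  proof -
    have "\<exists>a. X (u n) = scale a (v n)" if "n \<le> d" for n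
    proof -
      have "v n \<in> decomp scale q x d (k + 2) (l + 2) n"
        using v that by (simp add: normalized_basis_def)
      moreover have "X (u n) \<in> decomp scale q x d (k + 2) (l + 2) n"
        using exchanger_decomp[OF X kl(2)] u that by (simp add: normalized_basis_def)
      ultimately show ?thesis
        using decomp_multiple[OF kl(1) that] basis_seq_nonzero[OF basis that] by metis
    qed
    then show ?thesis by metis
  qed
  then obtain a where a: "\<And>n. n \<le> d \<Longrightarrow> X (u n) = scale (a n) (v n)" by blast
  have "(\<Sum>n\<le>d. scale (a n) (v n)) = X (\<Sum>n\<le>d. u n)"
    by (simp add: a X.sum)
  also have "\<dots> = (\<Sum>n\<le>d. scale c (v n))"
    using c u v by (simp add: normalized_basis_def scale_sum_right)
  finally have "a n = c" if "n \<le> d" for n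
    using basis_seq_coeffs_unique[OF basis, of a "\<lambda>_. c" n] that by simp
  then show ?thesis
    using a by (simp add: sends_to_multiple_def)
qed

text \<open>The flag \<open>[j]\<close> is carried to the flag \<open>[j + 2]\<close>, whose component 0 is a line.\<close>

lemma exchanger_flag_scalar:
  assumes X: "exchanger scale x X" and "\<eta> j \<in> flag scale q x d j 0"
    and "\<eta> (j + 2) \<in> flag scale q x d (j + 2) 0" and "\<eta> (j + 2) \<noteq> 0"
  obtains c where "X (\<eta> j) = scale c (\<eta> (j + 2))"
proof -
  interpret X: Vector_Spaces.linear scale scale X
    using X by (simp add: exchanger_def)
  have std: "std_index i (i + 1)" for i by (simp add: std_index_def)
  have "x (j + 2) (j + 2 + 1) (X (\<eta> j)) = scale (\<theta> 0) (X (\<eta> j))"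
    using exchanger_eq[OF X std, of j "\<eta> j"] assms(2)
    by (simp add: flag_0_iff X.scale add.commute add.left_commute)
  then have "X (\<eta> j) \<in> decomp scale q x d (j + 2) (j + 2 + 1) 0"
    unfolding decomp_iff[OF std] .
  moreover have "\<eta> (j + 2) \<in> decomp scale q x d (j + 2) (j + 2 + 1) 0"
    using assms(3) unfolding flag_0_iff decomp_iff[OF std] .
  moreover have "j + 2 \<noteq> j + 2 + 1" by simp
  ultimately show thesis
    using decomp_multiple assms(4) that by blast
qed

lemma exchanger_scalar_by_pairing:
  assumes X: "exchanger scale x X"
    and \<eta>: "\<And>h. \<eta> h \<in> flag scale q x d h 0" "\<And>h. \<eta> h \<noteq> 0"
    and f: "f \<in> dual_space scale"
    and scalar: "f (X (\<eta> j)) = c * f (\<eta> j)" and "f (\<eta> (j + 2)) \<noteq> 0"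
  shows "X (\<eta> j) = scale (c * (f (\<eta> j) / f (\<eta> (j + 2)))) (\<eta> (j + 2))"
proof -
  note f_simps = functional_simps[OF f]
  obtain a where a: "X (\<eta> j) = scale a (\<eta> (j + 2))"
    using exchanger_flag_scalar[OF X] \<eta> by metis
  then have "a = c * (f (\<eta> j) / f (\<eta> (j + 2)))"
    using scalar assms(6) by (simp add: f_simps field_simps)
  then show ?thesis using a by simp
qed

end


section \<open>The standard exchanger\<close>

text \<open>The vector \<open>w\<close> stands for \<open>\<eta> 2\<close> and \<open>b\<close> for \<open>[0,2,1,3]\<close>. Row \<open>n\<close> of the antidiagonal matrix of \<open>X\<close> has
  its nonzero entry in column \<open>d - n\<close>.\<close>

locale standard_exchange = basis_1_3 +
  fixes t :: 'a and X :: "'b \<Rightarrow> 'b" and w :: 'b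
  assumes exch: "exchanger scale x X"
    and t_nonzero: "t \<noteq> 0"
    and X_b: "\<And>n. n \<le> d \<Longrightarrow>
      X (b (d - n)) = scale (t ^ n * q powi (int n * (int d - 1) - int (d choose 2))) (b n)"
    and w_sum: "w = (\<Sum>n\<le>d. b n)" and x23_w: "x 2 3 w = scale (\<theta> 0) w"
begin

sublocale X: Vector_Spaces.linear scale scale X
  using exch by (simp add: exchanger_def)

lemma q_choose_two: "q ^ (d choose 2) * q powi (- 2 * int (d choose 2)) = q powi (- int (d choose 2))"
  using q_nonzero by (simp flip: power_int_of_nat power_int_add)

lemma X_b_last: "X (b d) = scale (q powi (- int (d choose 2))) (b 0)"
  using X_b[of 0] by simp

lemma X_b_first: "X (b 0) = scale (t ^ d * q ^ (d choose 2)) (b d)"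
  using X_b[of d] by (simp add: twice_choose_two)

text \<open>The exponents of \<open>t\<close> in the entries \<open>(n, d - n)\<close> and \<open>(d - n, n)\<close> add up to \<open>d\<close>, those of \<open>q\<close> to zero.\<close>

lemma X_X_b:
  assumes "n \<le> d"
  shows "X (X (b n)) = scale (t ^ d) (b n)"
proof -
  have "int (d - n) * (int d - 1) - int (d choose 2) + (int n * (int d - 1) - int (d choose 2)) = 0"
    using assms twice_choose_two by (simp add: of_nat_diff algebra_simps)
  then have "q powi (int (d - n) * (int d - 1) - int (d choose 2))
      * q powi (int n * (int d - 1) - int (d choose 2)) = 1"
    using q_nonzero by (metis power_int_add power_int_0_right)
  moreover have "t ^ (d - n) * t ^ n = t ^ d"
    using assms by (simp flip: power_add)
  ultimately show ?thesis
    using X_b[of n] X_b[of "d - n"] assms by (simp add: X.scale algebra_simps)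
qed

lemma functional_concentrated_sum:
  assumes "f \<in> dual_space scale" and "m \<le> d" and "\<And>n. n \<le> d \<Longrightarrow> n \<noteq> m \<Longrightarrow> f (b n) = 0"
  shows "f w = f (b m)"
proof -
  note f_simps = functional_simps[OF assms(1)]
  have "f w = (\<Sum>n\<le>d. if n = m then f (b n) else 0)"
    unfolding w_sum f_simps using assms(3) by (intro sum.cong) auto
  then show ?thesis using assms(2) by simp
qed

lemma functional_exchanged_sum:
  assumes "f \<in> dual_space scale" and "m \<le> d" and "\<And>n. n \<le> d \<Longrightarrow> n \<noteq> m \<Longrightarrow> f (b n) = 0"
  shows "f (X w) = f (X (b (d - m)))"
proof -
  note f_simps = functional_simps[OF assms(1)]
  have "f (X w) = (\<Sum>n\<le>d. if n = d - m then f (X (b n)) else 0)"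
    unfolding w_sum f_simps X.sum
  proof (rule sum.cong)
    fix n assume "n \<in> {..d}"
    then show "f (X (b n)) = (if n = d - m then f (X (b n)) else 0)"
      using X_b[of "d - n"] assms(3)[of "d - n"] by (auto simp: f_simps)
  qed simp
  then show ?thesis using assms(2) by simp
qed

text \<open>Here \<open>f\<close> is \<open>\<eta>' 3\<close>, which sees only \<open>b 0\<close>; the contribution to \<open>f (X w)\<close> comes from \<open>X (b d)\<close>.\<close>

lemma pairing_exchanged_2:
  assumes f: "f \<in> dual_space scale" and eig: "\<And>v. f (x 3 0 v) = \<theta> d * f v"
  shows "f (X w) = q powi (- int (d choose 2)) * f w"
proof -
  note f_simps = functional_simps[OF f]
  show ?thesis
    using functional_concentrated_sum[OF f, of 0] functional_exchanged_sum[OF f, of 0]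
      functional_concentrated_first[OF f, OF eig]
    by (simp add: X_b_last f_simps)
qed

text \<open>Here \<open>f\<close> is \<open>\<eta>' 1\<close>, which sees only \<open>b d\<close>, and \<open>y\<close> is \<open>\<eta> 0\<close>, reached from \<open>w\<close> by \<open>X\<close>; therefore \<open>X y\<close> is
  reduced to \<open>w\<close> by means of \<open>X \<circ> X\<close>.\<close>

lemma pairing_exchanged_0:
  assumes f: "f \<in> dual_space scale" and eig: "\<And>v. f (x 1 2 v) = \<theta> d * f v"
    and y: "X w = scale c y" and "w \<noteq> 0"
  shows "f (X y) = q powi (- int (d choose 2)) * f y"
proof -
  note f_simps = functional_simps[OF f]
  have "X (X w) = scale (t ^ d) w"
    by (simp add: w_sum X.sum X_X_b scale_sum_right)
  then have XXw: "scale c (X y) = scale (t ^ d) w"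
    using y by (simp add: X.scale)
  then have "c \<noteq> 0" using \<open>w \<noteq> 0\<close> t_nonzero by auto
  have "f w = f (b d)" and "f (X w) = f (X (b 0))"
    using functional_concentrated_sum[OF f, of d] functional_exchanged_sum[OF f, of d]
      functional_concentrated_last[OF f, OF eig] by simp_all
  then have "c * f y = t ^ d * q ^ (d choose 2) * f w"
    using y by (simp add: X_b_first f_simps)
  moreover have "c * f (X y) = t ^ d * f w"
    using arg_cong[OF XXw, of f] by (simp add: f_simps)
  ultimately have "c * (q ^ (d choose 2) * f (X y)) = c * f y"
    by (simp add: algebra_simps)
  then show ?thesis
    using \<open>c \<noteq> 0\<close> q_nonzero by (simp add: power_int_minus field_simps)
qed

text \<open>Here \<open>f\<close> is \<open>\<eta>' 2\<close> and \<open>y\<close> is \<open>\<eta> 3\<close>, a multiple of \<open>b d\<close>, which \<open>X\<close> sends to a multiple of \<open>b 0\<close>; the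
  values of \<open>f\<close> at the two ends are compared by \<open>functional_ends\<close>.\<close>

lemma pairing_exchanged_3:
  assumes f: "f \<in> dual_space scale" and eig: "\<And>v. f (x 2 3 v) = \<theta> d * f v"
    and y: "x 3 0 y = scale (\<theta> 0) y"
  shows "f (X y) = (- 1) ^ d * q ^ (d choose 2) * f y"
proof -
  note f_simps = functional_simps[OF f]
  obtain \<beta> where "y = scale \<beta> (b d)" using multiple_of_last[OF y] .
  moreover have "f (X (b d)) = (- 1) ^ d * q ^ (d choose 2) * f (b d)"
    unfolding functional_ends[OF x23_w[unfolded w_sum] f, OF eig] X_b_last f_simps q_choose_two[symmetric]
    by (simp flip: power_mult_distrib)
  ultimately show ?thesis
    by (simp add: X.scale f_simps)
qed

text \<open>Here \<open>f\<close> is \<open>\<eta>' 0\<close> and \<open>y\<close> is \<open>\<eta> 1\<close>. As \<open>X\<close> intertwines \<open>x 2 3\<close> with \<open>x 0 1\<close>, the functional \<open>f \<circ> X\<close>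
  belongs to the dual flag \<open>[2]\<close>, and \<open>functional_ends\<close> applies to it.\<close>

lemma pairing_exchanged_1:
  assumes f: "f \<in> dual_space scale" and eig: "\<And>v. f (x 0 1 v) = \<theta> d * f v"
    and y: "x 1 2 y = scale (\<theta> 0) y"
  shows "f (X y) = (- 1) ^ d * q ^ (d choose 2) * f y"
proof -
  note f_simps = functional_simps[OF f]
  let ?g = "\<lambda>v. f (X v)"
  have "?g (x 2 3 v) = \<theta> d * ?g v" for v
    using exchanger_eq[OF exch std_indices(5), of v] eig by simp
  then have "?g (b d) = (- 1) ^ d * q powi (- 2 * int (d choose 2)) * ?g (b 0)"
    by (rule functional_ends[OF x23_w[unfolded w_sum] functional_comp_exchanger[OF f X.linear_axioms]])
  then have "q powi (- int (d choose 2)) * f (b 0)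
      = (q ^ (d choose 2) * q powi (- 2 * int (d choose 2))) * ((- 1) ^ d * t ^ d * f (b d))"
    by (simp add: X_b_first X_b_last f_simps)
  then have "f (b 0) = (- 1) ^ d * t ^ d * f (b d)"
    unfolding q_choose_two using q_nonzero by simp
  moreover obtain \<alpha> where "y = scale \<alpha> (b 0)" using multiple_of_first[OF y] .
  ultimately show ?thesis
    by (simp add: X.scale f_simps X_b_first)
qed

end

theorem theorem15p17:
  fixes scale :: "'f::alg_closed_field \<Rightarrow> 'v::ab_group_add \<Rightarrow> 'v"
    and q t :: 'f
    and x :: "Z4 \<Rightarrow> Z4 \<Rightarrow> 'v \<Rightarrow> 'v"
    and d :: nat
    and \<eta> :: "Z4 \<Rightarrow> 'v"
    and \<eta>' :: "Z4 \<Rightarrow> 'v \<Rightarrow> 'f"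
    and X :: "'v \<Rightarrow> 'v"
    and i j k l :: Z4
    and u v :: "nat \<Rightarrow> 'v"
  assumes "q \<noteq> 0" and "\<And>n::nat. n > 0 \<Longrightarrow> q ^ n \<noteq> 1"
    and "evaluation_module scale q x d"
    and "evaluation_parameter scale q x d t"
    and "\<And>h. \<eta> h \<in> flag scale q x d h 0" and "\<And>h. \<eta> h \<noteq> 0"
    and "\<And>h. \<eta>' h \<in> dual_flag scale q x d h 0" and "\<And>h. \<eta>' h \<noteq> (\<lambda>_. 0)"
    and "standard_exchanger scale q x d t \<eta> X"
    and "distinct [i, j, k, l]"
    and "normalized_basis scale q x d \<eta> i j k l u"
    and "normalized_basis scale q x d \<eta> (i + 2) (j + 2) (k + 2) (l + 2) v"
  shows "sends_to_multiple scale d X u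
           (if j = 0 then q powi (- int (d choose 2)) * (\<eta>' 1 (\<eta> 0) / \<eta>' 1 (\<eta> 2))
            else if j = 1 then (-1) ^ d * q ^ (d choose 2) * (\<eta>' 0 (\<eta> 1) / \<eta>' 0 (\<eta> 3))
            else if j = 2 then q powi (- int (d choose 2)) * (\<eta>' 3 (\<eta> 2) / \<eta>' 3 (\<eta> 0))
            else (-1) ^ d * q ^ (d choose 2) * (\<eta>' 2 (\<eta> 3) / \<eta>' 2 (\<eta> 1)))
           v"
    (is "sends_to_multiple _ _ _ _ ?c _")
proof -
  interpret eval_module scale q x d
    using assms(1-3)
    by (simp add: eval_module_def eval_module_axioms_def evaluation_module_def boxtimes_module_def)
  note \<eta> = assms(5,6) and \<eta>' = assms(7,8)
  note eig = \<eta>(1)[unfolded flag_0_iff] and functional = dual_flag_0(1)[OF \<eta>'(1)]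
    and dual_eig = dual_flag_0(2)[OF \<eta>'(1)]
  have X: "exchanger scale x X"
    using assms(9) by (simp add: standard_exchanger_def)
  obtain b where b: "normalized_basis scale q x d \<eta> 0 2 1 3 b"
    and rep: "represents scale d b (mat (d + 1) (d + 1) (\<lambda>(i, j).
             if i + j = d then t ^ i * q powi (int i * (int d - 1) - int (d choose 2)) else 0)) X"
    using assms(9) by (auto simp: standard_exchanger_def)
  interpret standard_exchange scale q x d b t X "\<eta> 2"
  proof
    show "x 1 3 (b n) = scale (\<theta> n) (b n)" if "n \<le> d" for n
      using b that by (simp add: normalized_basis_def decomp_iff std_index_def)
    show "X (b (d - n)) = scale (t ^ n * q powi (int n * (int d - 1) - int (d choose 2))) (b n)"
      if "n \<le> d" for n
    proof -
      have "X (b (d - n)) = (\<Sum>i\<le>d. scale (if i + (d - n) = d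
          then t ^ i * q powi (int i * (int d - 1) - int (d choose 2)) else 0) (b i))"
        using rep unfolding represents_def by simp
      also have "\<dots> = (\<Sum>i\<le>d. if i = n
          then scale (t ^ i * q powi (int i * (int d - 1) - int (d choose 2))) (b i) else 0)"
        by (rule sum.cong) (use that in auto)
      finally show ?thesis using that by simp
    qed
    show "x 2 3 (\<eta> 2) = scale (\<theta> 0) (\<eta> 2)" using eig[of 2] by simp
  qed (use b X assms(4) in \<open>auto simp: normalized_basis_def evaluation_parameter_def\<close>)
  obtain c where c: "X (\<eta> 2) = scale c (\<eta> 0)"
    using exchanger_flag_scalar[of X \<eta> 2] X \<eta> by auto
  have "X (\<eta> j) = scale ?c (\<eta> (j + 2))"
  proof (cases j rule: Z4_cases)
    case 1
    have "\<eta>' 1 (X (\<eta> 0)) = q powi (- int (d choose 2)) * \<eta>' 1 (\<eta> 0)"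
      using pairing_exchanged_0[OF functional _ c] dual_eig[of 1] \<eta>(2) by simp
    moreover have "\<eta>' 1 (\<eta> 2) \<noteq> 0"
      using pairing_next_nonzero[of "\<eta> 2" 1 "\<eta>' 1"] \<eta> \<eta>' by simp
    ultimately show ?thesis
      using exchanger_scalar_by_pairing[OF X \<eta> functional, of 1 0] 1 by simp
  next
    case 2
    have "\<eta>' 0 (X (\<eta> 1)) = (- 1) ^ d * q ^ (d choose 2) * \<eta>' 0 (\<eta> 1)"
      using pairing_exchanged_1[OF functional] dual_eig[of 0] eig[of 1] by simp
    moreover have "\<eta>' 0 (\<eta> 3) \<noteq> 0"
      using pairing_previous_nonzero[of "\<eta> 3" 3 "\<eta>' 0"] \<eta> \<eta>' by simp
    ultimately show ?thesis
      using exchanger_scalar_by_pairing[OF X \<eta> functional, of 0 1] 2 by simp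
  next
    case 3
    have "\<eta>' 3 (X (\<eta> 2)) = q powi (- int (d choose 2)) * \<eta>' 3 (\<eta> 2)"
      using pairing_exchanged_2[OF functional] dual_eig[of 3] by simp
    moreover have "\<eta>' 3 (\<eta> 0) \<noteq> 0"
      using pairing_next_nonzero[of "\<eta> 0" 3 "\<eta>' 3"] \<eta> \<eta>' by simp
    ultimately show ?thesis
      using exchanger_scalar_by_pairing[OF X \<eta> functional, of 3 2] 3 by simp
  next
    case 4
    have "\<eta>' 2 (X (\<eta> 3)) = (- 1) ^ d * q ^ (d choose 2) * \<eta>' 2 (\<eta> 3)"
      using pairing_exchanged_3[OF functional] dual_eig[of 2] eig[of 3] by simp
    moreover have "\<eta>' 2 (\<eta> 1) \<noteq> 0"
      using pairing_previous_nonzero[of "\<eta> 1" 1 "\<eta>' 2"] \<eta> \<eta>' by simp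
    ultimately show ?thesis
      using exchanger_scalar_by_pairing[OF X \<eta> functional, of 2 3] 4 by simp
  qed
  then show ?thesis
    by (rule exchanger_normalized_basis[OF X assms(11,12)])
qed

end
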